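(* Let $0<|q|<1$. For $xy\neq q$, there holds $$\sum_{n=0}^{\infty}\frac{(x,y;q)_n}{(q;q)_{2n}}\left(\frac1{xy}\right)^n(q^n-1)q^{n^2}=(S_1-S_2)\frac{(q/x,q/y;q)_\infty}{(q,q/xy;q)_\infty},$$ where $S_1$ and $S_2$ are, respectively, given by $$S_1:=\sum_{n=-\infty}^{\infty}\frac{(x,y;q)_{3n}}{(q/x,q/y;q)_{3n}}\left(\frac1{xy}\right)^{3n}q^{3n^2+n}(q^n-1),$$ $$S_2:=\sum_{n=-\infty}^{\infty}\frac{(x,y;q)_{3n+1}}{(q/x,q/y;q)_{3n+1}}\left(\frac1{xy}\right)^{3n+1}q^{3n^2+4n+1}(1-q^{3n+1}).$$
   Context: Here $x,y$ are the parameters of the identity and $q$ is the base. The $q$-shifted factorials are $(x;q)_\infty=\prod_{n=0}^{\infty}(1-xq^n)$ and $(x;q)_n=(x;q)_\infty/(xq^n;q)_\infty$ for all integers $n$ (including negative $n$). Compact notation: $(a_1,\dots,a_r;q)_n=(a_1;q)_n\cdots(a_r;q)_n$, also for $n=\infty$. Here $q/xy$ means $q/(xy)$.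
   Formalization: Assumes x, y nonzero, xy ≠ q^m and x, y ≠ q^m for all m ≥ 1, not just xy ≠ q: if xy = q^m then (q/xy;q)_∞ = 0 and the right side divides by zero; if x or y = q^m then terms of S_1 and S_2 have vanishing denominators. *)

theory Defs
  imports "HOL-Analysis.Analysis"
begin

definition qpoch_inf :: "complex \<Rightarrow> complex \<Rightarrow> complex" where
  "qpoch_inf a q = (\<Prod>n. 1 - a * q ^ n)"

text \<open>
  The shifted factorial of integer order is the quotient of two infinite products wherever that
  quotient is defined. If its denominator vanishes, the cancelled finite product is used instead.
  For a quotient \<open>0/0\<close> this is the usual value, as in terminating sums. Otherwise \<open>n\<close> is negative
  and there is a genuine pole, where the value is \<open>1/0 = 0\<close>. For \<open>0 < norm q < 1\<close> the cancelled
  form agrees with the definition everywhere, by the lemmas below.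
\<close>

definition qpoch :: "complex \<Rightarrow> complex \<Rightarrow> int \<Rightarrow> complex" where
  "qpoch a q n =
     (if qpoch_inf (a * q powi n) q \<noteq> 0 then qpoch_inf a q / qpoch_inf (a * q powi n) q
      else if n \<ge> 0 then (\<Prod>k<nat n. 1 - a * q ^ k)
      else 1 / (\<Prod>k<nat (- n). 1 - (a * q powi n) * q ^ k))"

lemma qpoch_inf_split:
  assumes "norm q < 1"
  shows "qpoch_inf a q = (\<Prod>k<n. 1 - a * q ^ k) * qpoch_inf (a * q ^ n) q"
proof -
  have "summable (\<lambda>k. norm a * norm q ^ k)"
    using assms by (intro summable_mult summable_geometric) auto
  hence "convergent_prod (\<lambda>k. 1 - a * q ^ k)"
    by (intro abs_convergent_prod_imp_convergent_prod)
       (simp add: abs_convergent_prod_conv_summable norm_mult norm_power)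
  from has_prod_ignore_initial_segment'[OF this, of n]
  show ?thesis
    by (simp add: qpoch_inf_def has_prod_iff power_add mult_ac)
qed

lemma qpoch_of_nat:
  assumes "norm q < 1"
  shows "qpoch a q (int n) = (\<Prod>k<n. 1 - a * q ^ k)"
  using qpoch_inf_split[OF assms, of a n] by (simp add: qpoch_def)

lemma qpoch_minus_of_nat:
  assumes "0 < norm q" "norm q < 1"
  shows "qpoch a q (- int n) = 1 / (\<Prod>k<n. 1 - (a * q powi (- int n)) * q ^ k)"
proof -
  have "q \<noteq> 0"
    using assms by auto
  hence "a * q powi (- int n) * q ^ n = a"
    by (simp add: power_int_minus)
  with qpoch_inf_split[OF assms(2), of "a * q powi (- int n)" n]
  have "qpoch_inf (a * q powi (- int n)) q =
          (\<Prod>k<n. 1 - (a * q powi (- int n)) * q ^ k) * qpoch_inf a q"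
    by simp
  thus ?thesis
    by (auto simp: qpoch_def)
qed

text \<open>
  If \<open>x\<close> or \<open>y\<close> is \<open>q powi (- m)\<close> with \<open>m \<ge> 0\<close>, the factors \<open>qpoch (q / x) q n\<close> or
  \<open>qpoch (q / y) q n\<close> have poles for \<open>n < - m\<close>. The corresponding terms then evaluate to
  \<open>c / 0 = 0\<close>, which is their limit.
\<close>

definition S1_term :: "complex \<Rightarrow> complex \<Rightarrow> complex \<Rightarrow> int \<Rightarrow> complex" where
  "S1_term x y q n =
     (qpoch x q (3 * n) * qpoch y q (3 * n))
       / (qpoch (q / x) q (3 * n) * qpoch (q / y) q (3 * n))
     * (1 / (x * y)) powi (3 * n) * q powi (3 * n\<^sup>2 + n) * (q powi n - 1)"

definition S2_term :: "complex \<Rightarrow> complex \<Rightarrow> complex \<Rightarrow> int \<Rightarrow> complex" where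
  "S2_term x y q n =
     (qpoch x q (3 * n + 1) * qpoch y q (3 * n + 1))
       / (qpoch (q / x) q (3 * n + 1) * qpoch (q / y) q (3 * n + 1))
     * (1 / (x * y)) powi (3 * n + 1) * q powi (3 * n\<^sup>2 + 4 * n + 1) * (1 - q powi (3 * n + 1))"

definition S1 :: "complex \<Rightarrow> complex \<Rightarrow> complex \<Rightarrow> complex" where
  "S1 x y q = (\<Sum>\<^sub>\<infinity>n\<in>UNIV. S1_term x y q n)"

definition S2 :: "complex \<Rightarrow> complex \<Rightarrow> complex \<Rightarrow> complex" where
  "S2 x y q = (\<Sum>\<^sub>\<infinity>n\<in>UNIV. S2_term x y q n)"

end

theory Submission
  imports Defs
begin

text \<open>
  With \<open>d = q / (x y)\<close> and \<open>c n r = 1 / ((q)\<^bsub>n-r\<^esub> (q)\<^bsub>n+r\<^esub>)\<close> (zero for \<open>\<bar>r\<bar> > n\<close>), the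
  q-Pfaff--Saalschuetz sum gives, for every integer \<open>r\<close>, the finite form of Bailey's lemma
  \<open>\<Sum>n\<le>N. (x)\<^bsub>n\<^esub> (y)\<^bsub>n\<^esub> (d)\<^bsub>N-n\<^esub> d\<^sup>n / (q)\<^bsub>N-n\<^esub> * c n r = (q/x)\<^bsub>N\<^esub> (q/y)\<^bsub>N\<^esub> c N r \<rho>(r)\<close> with
  \<open>\<rho>(r) = (x)\<^bsub>r\<^esub> (y)\<^bsub>r\<^esub> / ((q/x)\<^bsub>r\<^esub> (q/y)\<^bsub>r\<^esub>) d\<^sup>r\<close>. The summands of the two bilateral series are
  \<open>a(3n) \<rho>(3n)\<close> and \<open>- a(3n+1) \<rho>(3n+1)\<close> for coefficients \<open>a\<close> which, extended by
  \<open>a(3n+2) = 0\<close>, satisfy \<open>\<Sum>r. a(r) c n r = q\<^bsup>n^2-n\<^esup> (q\<^sup>n - 1) / (q)\<^bsub>2n\<^esub>\<close>. This Bailey pair is the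
  difference of two classical ones, and these come from the identity
  \<open>\<Sum>j. (-1)\<^sup>j q\<^bsup>j(3j+1)/2\<^esup> [m, \<lfloor>(m-3j)/2\<rfloor>] = 1\<close> for Gaussian binomials. Letting \<open>N \<rightarrow> \<infinity>\<close> in the finite
  form needs no assumption on \<open>\<bar>d\<bar>\<close>, because \<open>a(r)\<close> and the right-hand side of the Bailey pair decay
  like theta series.
\<close>

section \<open>Finite shifted factorials of natural order\<close>

definition qfac :: "complex \<Rightarrow> complex \<Rightarrow> nat \<Rightarrow> complex" where
  "qfac q a n = (\<Prod>k<n. 1 - a * q ^ k)"

lemma qfac_0 [simp]: "qfac q a 0 = 1"
  by (simp add: qfac_def)

lemma qfac_Suc: "qfac q a (Suc n) = qfac q a n * (1 - a * q ^ n)"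
  by (simp add: qfac_def)

lemma qfac_add: "qfac q a (m + n) = qfac q a m * qfac q (a * q ^ m) n"
  by (induction n) (simp_all add: qfac_Suc power_add mult_ac)

lemma power_neq_1_of_norm_less_1:
  fixes q :: complex
  assumes "norm q < 1" "n > 0"
  shows "q ^ n \<noteq> 1"
proof
  assume "q ^ n = 1"
  hence "norm q ^ n = 1"
    by (metis norm_one norm_power)
  moreover have "norm q ^ n < 1"
    using assms by (simp add: power_less_one_iff)
  ultimately show False by simp
qed

lemma qfac_base_power_nonzero:
  assumes "norm q < 1" "m > 0"
  shows "qfac q (q ^ m) n \<noteq> 0"
  using power_neq_1_of_norm_less_1[OF assms(1)] assms(2)
  by (auto simp: qfac_def simp flip: power_add)

lemma qfac_base_nonzero: "norm q < 1 \<Longrightarrow> qfac q q n \<noteq> 0"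
  using qfac_base_power_nonzero[of q 1] by simp

subsection \<open>The q-Pfaff--Saalschuetz sum\<close>

text \<open>The summand of the balanced 3phi2 series with upper parameters
  \<open>a, b, q^(-m)\<close> and lower parameters \<open>a b d, q^(1-m)/d\<close>, multiplied by
  \<open>(d)_m / (q)_m\<close>. In this form no negative power of \<open>q\<close> occurs.\<close>

definition saalschutz_term :: "complex \<Rightarrow> complex \<Rightarrow> complex \<Rightarrow> complex \<Rightarrow> nat \<Rightarrow> nat \<Rightarrow> complex" where
  "saalschutz_term q a b d m k = qfac q a k * qfac q b k * qfac q d (m - k) * d ^ k
     / (qfac q q (m - k) * qfac q q k * qfac q (a * b * d) k)"

text \<open>
  Wilf--Zeilberger: the recurrence satisfied by the closed form, applied to a single summand, is a
  difference in the summation index.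
\<close>

lemma saalschutz_term_telescopes:
  assumes "\<And>n. qfac q q n \<noteq> 0" "\<And>n. qfac q (a * b * d) n \<noteq> 0" "k \<le> m"
  shows "(\<Sum>i\<le>k. (1 - a*b*d*q^m) * (1 - q^Suc m) * saalschutz_term q a b d (Suc m) i
            - (1 - a*d*q^m) * (1 - b*d*q^m) * saalschutz_term q a b d m i)
         = - (d * q^(m - k) * (1 - a*q^k) * (1 - b*q^k) * saalschutz_term q a b d m k)"
  using assms(3)
proof (induction k)
  case 0
  have nz: "qfac q q m \<noteq> 0" "1 - q * q ^ m \<noteq> 0"
    using assms(1)[of "Suc m"] by (auto simp: qfac_Suc)
  show ?case
    using nz by (simp add: saalschutz_term_def qfac_Suc field_simps) 
next
  case (Suc k)
  \<comment> \<open>\<open>j = m - k - 1\<close> removes the truncated subtractions, and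
    \<open>\<Phi>\<close> below is the common factor of the three summands involved, so that a
    polynomial identity remains.\<close>
  then obtain j where m: "m = Suc (k + j)"
    by (metis add_Suc less_eqE)
  define c where "c = a * b * d"
  define \<Phi> where "\<Phi> = qfac q a k * qfac q b k * qfac q d j * d ^ k
     / (qfac q q (Suc j) * qfac q q (Suc k) * qfac q c (Suc k))"
  have nz: "1 - q * q ^ j \<noteq> 0" "1 - q * q ^ k \<noteq> 0" "1 - c * q ^ k \<noteq> 0"
    "qfac q q j \<noteq> 0" "qfac q q k \<noteq> 0" "qfac q c k \<noteq> 0"
    using assms(1)[of "Suc j"] assms(1)[of "Suc k"] assms(2)[of "Suc k"]
    by (auto simp: qfac_Suc c_def)
  have 1: "saalschutz_term q a b d (Suc m) (Suc k)
      = \<Phi> * (d * (1 - a*q^k) * (1 - b*q^k) * (1 - d*q^j))"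
    unfolding saalschutz_term_def \<Phi>_def m c_def by (simp add: qfac_Suc mult_ac)
  have 2: "saalschutz_term q a b d m (Suc k)
      = \<Phi> * (d * (1 - a*q^k) * (1 - b*q^k) * (1 - q * q^j))"
    using nz unfolding saalschutz_term_def \<Phi>_def m c_def by (simp add: qfac_Suc mult_ac)
  have mk: "Suc (k + j) - k = Suc j" "Suc (k + j) - Suc k = j" by auto
  have 3: "saalschutz_term q a b d m k = \<Phi> * ((1 - d*q^j) * (1 - q*q^k) * (1 - c*q^k))"
    using nz unfolding saalschutz_term_def \<Phi>_def m mk c_def by (simp add: qfac_Suc mult_ac)
  have IH: "(\<Sum>i\<le>k. (1 - a*b*d*q^m) * (1 - q^Suc m) * saalschutz_term q a b d (Suc m) i
            - (1 - a*d*q^m) * (1 - b*d*q^m) * saalschutz_term q a b d m i)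
         = - (d * q^(m - k) * (1 - a*q^k) * (1 - b*q^k) * saalschutz_term q a b d m k)"
    using Suc by simp
  show ?case
    unfolding sum.atMost_Suc IH 1 2 3 unfolding m mk c_def
    by (simp add: power_add) algebra
qed

text \<open>The telescoped sum up to \<open>k = m\<close> cancels against the extra summand
  \<open>k = m + 1\<close> of order \<open>m + 1\<close>, so the sum obeys the first-order
  recurrence of the closed form.\<close>

theorem q_pfaff_saalschutz:
  assumes "\<And>n. qfac q q n \<noteq> 0" "\<And>n. qfac q (a * b * d) n \<noteq> 0"
  shows "(\<Sum>k\<le>m. saalschutz_term q a b d m k)
     = qfac q (a * d) m * qfac q (b * d) m / (qfac q q m * qfac q (a * b * d) m)"
proof (induction m)
  case 0
  show ?case by (simp add: saalschutz_term_def)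
next
  case (Suc m)
  let ?c = "(1 - a*b*d*q^m) * (1 - q^Suc m)" and ?e = "(1 - a*d*q^m) * (1 - b*d*q^m)"
  have nz: "1 - q * q ^ m \<noteq> 0" "1 - a*b*d * q ^ m \<noteq> 0" "qfac q q m \<noteq> 0"
      "qfac q (a*b*d) m \<noteq> 0"
    using assms(1)[of "Suc m"] assms(2)[of "Suc m"] by (auto simp: qfac_Suc)
  have last: "?c * saalschutz_term q a b d (Suc m) (Suc m)
      = d * (1 - a*q^m) * (1 - b*q^m) * saalschutz_term q a b d m m"
    using nz by (simp add: saalschutz_term_def qfac_Suc)
  have "?c * (\<Sum>k\<le>m. saalschutz_term q a b d (Suc m) k) - ?e * (\<Sum>k\<le>m. saalschutz_term q a b d m k)
      = - (d * (1 - a*q^m) * (1 - b*q^m) * saalschutz_term q a b d m m)"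
    using saalschutz_term_telescopes[OF assms, of m m]
    by (simp add: sum_subtractf sum_distrib_left)
  hence "?c * (\<Sum>k\<le>m. saalschutz_term q a b d (Suc m) k)
      = ?e * (\<Sum>k\<le>m. saalschutz_term q a b d m k) - d * (1 - a*q^m) * (1 - b*q^m) * saalschutz_term q a b d m m"
    by (simp only: diff_eq_eq) simp
  hence "?c * (\<Sum>k\<le>Suc m. saalschutz_term q a b d (Suc m) k) = ?e * (\<Sum>k\<le>m. saalschutz_term q a b d m k)"
    unfolding sum.atMost_Suc distrib_left last
    by simp
  hence "(\<Sum>k\<le>Suc m. saalschutz_term q a b d (Suc m) k) = ?e * (\<Sum>k\<le>m. saalschutz_term q a b d m k) / ?c"
    using nz by (simp add: nonzero_eq_divide_eq mult.commute)
  also have "\<dots> = qfac q (a * d) (Suc m) * qfac q (b * d) (Suc m)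
      / (qfac q q (Suc m) * qfac q (a * b * d) (Suc m))"
    unfolding Suc by (simp add: qfac_Suc mult_ac)
  finally show ?case .
qed

subsection \<open>Gaussian binomials and Bailey pairs modulo 3\<close>

lemma power_int_mult_eq:
  fixes q :: complex
  assumes "q \<noteq> 0" "i + j = k + l"
  shows "q powi i * q powi j = q powi k * q powi l"
  using assms by (metis power_int_add)

lemma power_int_mult_eq':
  fixes q :: complex
  assumes "q \<noteq> 0" "i + j = k"
  shows "q powi i * q powi j = q powi k"
  using assms by (metis power_int_add)

text \<open>The integer lower index allows bilateral sums without range conditions. The definition
  by a q-Pascal rule avoids quotients of factorials.\<close>

fun gauss_binom :: "complex \<Rightarrow> nat \<Rightarrow> int \<Rightarrow> complex" where
  "gauss_binom q 0 k = (if k = 0 then 1 else 0)"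
| "gauss_binom q (Suc m) k = q powi k * gauss_binom q m k + gauss_binom q m (k - 1)"

lemma gauss_binom_outside: "k < 0 \<or> k > int m \<Longrightarrow> gauss_binom q m k = 0"
  by (induction m arbitrary: k) auto

text \<open>The second q-Pascal rule, by expansion with the first; \<open>e\<close> regroups the
  coefficient of \<open>gauss_binom q m (k - 1)\<close>.\<close>

lemma gauss_binom_Suc':
  assumes "q \<noteq> 0"
  shows "gauss_binom q (Suc m) k = gauss_binom q m k + q powi (int m + 1 - k) * gauss_binom q m (k - 1)"
proof (induction m arbitrary: k)
  case 0
  then show ?case by simp
next
  case (Suc m)
  have e: "q powi k * q powi (int m + 1 - k) = q powi (int m + 2 - k) * q powi (k - 1)"
    using assms by (simp flip: power_int_add)
  have "gauss_binom q (Suc (Suc m)) k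
      = q powi k * gauss_binom q (Suc m) k + gauss_binom q (Suc m) (k - 1)"
    by simp
  also have "\<dots> = q powi k * (gauss_binom q m k + q powi (int m + 1 - k) * gauss_binom q m (k - 1))
      + (gauss_binom q m (k - 1) + q powi (int m + 1 - (k - 1)) * gauss_binom q m (k - 1 - 1))"
    unfolding Suc by simp
  also have "int m + 1 - (k - 1) = int m + 2 - k" by simp
  also have "q powi k * (gauss_binom q m k + q powi (int m + 1 - k) * gauss_binom q m (k - 1))
      = q powi k * gauss_binom q m k + q powi k * q powi (int m + 1 - k) * gauss_binom q m (k - 1)"
    by (simp add: algebra_simps)
  also note e
  finally show ?case by (simp add: algebra_simps)
qed

text \<open>The reflection exchanges the two q-Pascal rules.\<close>

lemma gauss_binom_sym:
  assumes "q \<noteq> 0"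
  shows "gauss_binom q m (int m - k) = gauss_binom q m k"
proof (induction m arbitrary: k)
  case (Suc m)
  have "gauss_binom q (Suc m) (int (Suc m) - k)
     = gauss_binom q m (int m - (k - 1)) + q powi k * gauss_binom q m (int m - k)"
    by (subst gauss_binom_Suc'[OF assms]) (simp add: algebra_simps)
  also have "\<dots> = gauss_binom q (Suc m) k"
    unfolding Suc by simp
  finally show ?case .
qed auto

text \<open>The power of \<open>q\<close> turns the first q-Pascal rule for base
  \<open>inverse q\<close> into the second one for base \<open>q\<close>. This drives the later
  replacement of \<open>q\<close> by \<open>1/q\<close> in Bailey pairs.\<close>

lemma gauss_binom_inverse:
  assumes "q \<noteq> 0"
  shows "gauss_binom (inverse q) m k = q powi (k * (k - int m)) * gauss_binom q m k"
proof (induction m arbitrary: k)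
  case (Suc m)
  have 1: "inverse q powi k * q powi (k * (k - int m)) = q powi (k * (k - int (Suc m)))"
    using assms by (simp add: power_int_inverse field_simps flip: power_int_minus power_int_add)
  have 2: "q powi ((k-1) * (k - 1 - int m)) = q powi (k * (k - int (Suc m))) * q powi (int m + 1 - k)"
    using assms by (simp add: algebra_simps flip: power_int_add)
  have "gauss_binom (inverse q) (Suc m) k
     = (inverse q powi k * q powi (k * (k - int m))) * gauss_binom q m k
       + q powi ((k-1) * (k - 1 - int m)) * gauss_binom q m (k - 1)"
    by (simp add: Suc)
  also have "\<dots> = q powi (k * (k - int (Suc m))) *
      (gauss_binom q m k + q powi (int m + 1 - k) * gauss_binom q m (k - 1))"
    unfolding 1 2 by (simp add: algebra_simps)
  finally show ?case
    by (simp only: gauss_binom_Suc'[OF assms])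
qed auto

text \<open>The support is finite, because the lower index leaves \<open>0..m\<close> for large
  \<open>\<bar>r\<bar>\<close>.\<close>

lemma summable_on_gauss_binom:
  "(\<lambda>r::int. f r * gauss_binom q m (b - 3 * r)) summable_on UNIV"
proof -
  have "(\<lambda>r::int. f r * gauss_binom q m (b - 3 * r)) summable_on {- (\<bar>b\<bar> + int m)..\<bar>b\<bar> + int m}"
    by simp
  also have "?this \<longleftrightarrow> ?thesis"
    by (intro summable_on_cong_neutral) (auto intro!: gauss_binom_outside)
  finally show ?thesis .
qed

lemma has_sum_diff_complex:
  fixes f g :: "'a \<Rightarrow> complex"
  assumes "(f has_sum a) A" "(g has_sum b) A"
  shows "((\<lambda>x. f x - g x) has_sum a - b) A"
  using has_sum_add[OF assms(1) has_sum_uminusI[OF assms(2)]] by simp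

lemma has_sum_int_shift:
  fixes f :: "int \<Rightarrow> complex"
  assumes "(f has_sum s) UNIV"
  shows "((\<lambda>r. f (r + c)) has_sum s) UNIV"
proof -
  have "bij_betw (\<lambda>r::int. r + c) UNIV UNIV"
    by (rule bij_betwI[of _ _ _ "\<lambda>r. r - c"]) auto
  from has_sum_reindex_bij_betw[OF this, of f s] assms show ?thesis by simp
qed

text \<open>
  The summands are those of \<open>\<Sum>j. (-1)\<^sup>j q\<^bsup>j(3j+1)/2\<^esup> [m, \<lfloor>(m-3j)/2\<rfloor>]\<close> for \<open>j = 2r\<close> and \<open>j = 2r+1\<close>.
  By the two Pascal rules, passing from \<open>m\<close> to \<open>m+1\<close> does not change the summands for even \<open>m\<close>
  and adds a telescoping series for odd \<open>m\<close>.
\<close>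

lemma schur_mod_3:
  fixes q :: complex
  assumes "q \<noteq> 0"
  shows "((\<lambda>r. q powi (6*r^2 + r) * gauss_binom q (2*n) (int n - 3*r)
             - q powi (6*r^2 + 7*r + 2) * gauss_binom q (2*n) (int n - 3*r - 2)) has_sum 1) UNIV"
    (is "(?E n has_sum 1) UNIV")
  and "((\<lambda>r. q powi (6*r^2 + r) * gauss_binom q (2*n + 1) (int n - 3*r)
             - q powi (6*r^2 + 7*r + 2) * gauss_binom q (2*n + 1) (int n - 3*r - 1)) has_sum 1) UNIV"
    (is "(?O n has_sum 1) UNIV")
proof -
  \<comment> \<open>The Pascal rules produce a multiple of \<open>[2n, n-3r-1]\<close> in both parts
    of the summand; by \<open>e\<close> the two coefficients agree, so these cancel.\<close>
  have even_odd: "?O n r = ?E n r" for n r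
  proof -
    have 1: "gauss_binom q (2*n + 1) (int n - 3*r)
        = gauss_binom q (2*n) (int n - 3*r) + q powi (int n + 3*r + 1) * gauss_binom q (2*n) (int n - 3*r - 1)"
      using gauss_binom_Suc'[OF assms, of "2*n" "int n - 3*r"] by (simp add: algebra_simps)
    have 2: "gauss_binom q (2*n + 1) (int n - 3*r - 1)
        = q powi (int n - 3*r - 1) * gauss_binom q (2*n) (int n - 3*r - 1)
          + gauss_binom q (2*n) (int n - 3*r - 2)"
      by (simp add: algebra_simps)
    have e: "q powi (6*r^2 + r) * q powi (int n + 3*r + 1)
        = q powi (6*r^2 + 7*r + 2) * q powi (int n - 3*r - 1)"
      using assms by (intro power_int_mult_eq) simp_all
    show ?thesis
      unfolding 1 2 using e by algebra
  qed
  have odd_even: "(?E (Suc n) has_sum 1) UNIV" if "(?O n has_sum 1) UNIV" for n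
  proof -
    \<comment> \<open>Each of the two binomials leaves one surplus term under the Pascal rules. That
      of the first is \<open>X r\<close>, that of the second is \<open>X (r + 1)\<close>.\<close>
    define X where "X r = q powi (6*r^2 - 2*r + int n + 1) * gauss_binom q (2*n + 1) (int n + 1 - 3*r)" for r
    have "X summable_on UNIV"
      unfolding X_def by (rule summable_on_gauss_binom)
    then obtain s where s: "(X has_sum s) UNIV"
      by (auto simp: summable_on_def)
    have E: "?E (Suc n) r = ?O n r + (X r - X (r + 1))" for r
    proof -
      have 1: "gauss_binom q (2 * Suc n) (int (Suc n) - 3*r)
          = q powi (int n + 1 - 3*r) * gauss_binom q (2*n + 1) (int n + 1 - 3*r)
            + gauss_binom q (2*n + 1) (int n - 3*r)"
        by (simp add: algebra_simps del: gauss_binom.simps) (simp add: algebra_simps)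
      have 2: "gauss_binom q (2 * Suc n) (int (Suc n) - 3*r - 2)
          = gauss_binom q (2*n + 1) (int n - 3*r - 1)
            + q powi (int n + 3*r + 3) * gauss_binom q (2*n + 1) (int n - 3*r - 2)"
        using gauss_binom_Suc'[OF assms, of "2*n+1" "int n - 3*r - 1"]
        by (simp add: algebra_simps del: gauss_binom.simps)
      have 3: "q powi (6*r^2 + r) * q powi (int n + 1 - 3*r) = q powi (6*r^2 - 2*r + int n + 1)"
        using assms by (intro power_int_mult_eq') (simp_all add: power2_eq_square algebra_simps)
      have 4: "q powi (6*r^2 + 7*r + 2) * q powi (int n + 3*r + 3)
          = q powi (6*(r+1)^2 - 2*(r+1) + int n + 1)"
        using assms by (intro power_int_mult_eq') (simp_all add: power2_eq_square algebra_simps)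
      have 5: "X (r + 1) = q powi (6*r^2 + 7*r + 2) * q powi (int n + 3*r + 3)
          * gauss_binom q (2*n + 1) (int n - 3*r - 2)"
        unfolding 4 X_def by (simp add: algebra_simps del: gauss_binom.simps)
      show ?thesis
        unfolding 1 2 5 unfolding X_def 3[symmetric] by (simp add: algebra_simps del: gauss_binom.simps)
    qed
    have "((\<lambda>r. ?O n r + (X r - X (r + 1))) has_sum 1 + (s - s)) UNIV"
      by (intro has_sum_add has_sum_diff_complex that s has_sum_int_shift)
    thus ?thesis
      unfolding E by simp
  qed
  show E: "(?E n has_sum 1) UNIV" for n
  proof (induction n)
    case 0
    \<comment> \<open>At \<open>n = 0\<close> only \<open>r = 0\<close> contributes: the first lower
      index is \<open>- 3r\<close>, and the second, \<open>- 3r - 2\<close>, is never 0.\<close>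
    have "(?E 0 has_sum sum (?E 0) {0}) {0}"
      by (intro has_sum_finite) auto
    hence "(?E 0 has_sum 1) {0}"
      by simp
    also have "?this \<longleftrightarrow> (?E 0 has_sum 1) UNIV"
      by (intro has_sum_cong_neutral) auto
    finally show ?case .
  next
    case (Suc n)
    then show ?case
      using odd_even[of n] unfolding even_odd by blast
  qed
  show "(?O n has_sum 1) UNIV"
    unfolding even_odd by (rule E)
qed

text \<open>Each half is summable by itself, so the two halves may be reindexed
  independently.\<close>

lemma has_sum_diff_reindex:
  fixes f g :: "int \<Rightarrow> complex"
  assumes "((\<lambda>r. f r - g r) has_sum s) UNIV" "f summable_on UNIV" "g summable_on UNIV"
    and "bij \<phi>" "bij \<psi>"
  shows "((\<lambda>r. f (\<phi> r) - g (\<psi> r)) has_sum s) UNIV"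
proof -
  obtain s1 s2 where s: "(f has_sum s1) UNIV" "(g has_sum s2) UNIV"
    using assms(2,3) by (auto simp: summable_on_def)
  have "s = s1 - s2"
    using assms(1) has_sum_diff_complex[OF s] has_sum_unique by blast
  moreover have "((\<lambda>r. f (\<phi> r)) has_sum s1) UNIV" "((\<lambda>r. g (\<psi> r)) has_sum s2) UNIV"
    using has_sum_reindex_bij_betw[OF assms(4), of f s1] has_sum_reindex_bij_betw[OF assms(5), of g s2] s
    by simp_all
  ultimately show ?thesis
    by (auto intro: has_sum_diff_complex)
qed

lemma bij_int_uminus_minus: "bij (\<lambda>r::int. - r - c)"
  by (rule bij_betwI[of _ _ _ "\<lambda>r. - r - c"]) auto

lemma summable_on_gauss_binom':
  "(\<lambda>r::int. f r * gauss_binom q m (b - 3 * r - c)) summable_on UNIV"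
  using summable_on_gauss_binom[of f q m "b - c"] by (simp add: algebra_simps)

text \<open>
  The numbering is that of group A in Slater's list of Bailey pairs. The pairs A(5) and A(7) are
  obtained from A(1) and A(3) by replacing \<open>q\<close> with \<open>1/q\<close>.
\<close>

lemma slater_A1:
  fixes q :: complex
  assumes "q \<noteq> 0"
  shows "((\<lambda>r. q powi (6*r^2 + r) * gauss_binom q (2*n) (int n - 3*r)
             - q powi (6*r^2 + 5*r + 1) * gauss_binom q (2*n) (int n - 3*r - 1)) has_sum 1) UNIV"
proof -
  \<comment> \<open>Only the second half is reindexed, by \<open>r \<mapsto> - r - 1\<close>; the
    symmetry of the binomials then restores the form of its lower index.\<close>
  have "((\<lambda>r. q powi (6*r^2 + r) * gauss_binom q (2*n) (int n - 3*r)
      - q powi (6*(- r - 1)^2 + 7*(- r - 1) + 2) * gauss_binom q (2*n) (int n - 3*(- r - 1) - 2))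
      has_sum 1) UNIV"
    by (rule has_sum_diff_reindex[OF schur_mod_3(1)[OF assms] summable_on_gauss_binom
          summable_on_gauss_binom' bij_id[unfolded id_def] bij_int_uminus_minus])
  moreover have "gauss_binom q (2*n) (int n - 3*(- r - 1) - 2) = gauss_binom q (2*n) (int n - 3*r - 1)" for r
    using gauss_binom_sym[OF assms, of "2*n" "int n - 3*r - 1"] by (simp add: algebra_simps)
  moreover have "6*(- r - 1)^2 + 7*(- r - 1) + 2 = 6*r^2 + 5*r + 1" for r :: int
    by (simp add: power2_eq_square algebra_simps)
  ultimately show ?thesis by (simp only:)
qed

text \<open>For \<open>n = m + 1\<close>, the Pascal rules give both binomials the same term
  \<open>[2m+1, m-3r]\<close>, which cancels. What remains is \<open>q^n\<close> times the odd case
  of \<open>schur_mod_3\<close>, reindexed and reflected.\<close>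

lemma slater_A3:
  fixes q :: complex
  assumes "q \<noteq> 0"
  shows "((\<lambda>r. q powi (6*r^2 + 2*r) * gauss_binom q (2*n) (int n - 3*r)
             - q powi (6*r^2 + 2*r) * gauss_binom q (2*n) (int n - 3*r - 1)) has_sum q ^ n) UNIV"
proof (cases n)
  case 0
  show ?thesis
    unfolding 0 by (rule has_sum_finite_neutralI[of "{0}"]) auto
next
  case (Suc m)
  have "((\<lambda>r. q powi (6*(- r)^2 + - r) * gauss_binom q (2*m + 1) (int m - 3*(- r))
      - q powi (6*(- r - 1)^2 + 7*(- r - 1) + 2) * gauss_binom q (2*m + 1) (int m - 3*(- r - 1) - 1))
      has_sum 1) UNIV"
    by (rule has_sum_diff_reindex[OF schur_mod_3(2)[OF assms] summable_on_gauss_binom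
          summable_on_gauss_binom' bij_uminus bij_int_uminus_minus])
  moreover have "gauss_binom q (2*m + 1) (int m - 3*(- r)) = gauss_binom q (2*m + 1) (int m + 1 - 3*r)" for r
    using gauss_binom_sym[OF assms, of "2*m+1" "int m + 1 - 3*r"] by (simp add: algebra_simps del: gauss_binom.simps)
  moreover have "gauss_binom q (2*m + 1) (int m - 3*(- r - 1) - 1) = gauss_binom q (2*m + 1) (int m - 3*r - 1)" for r
    using gauss_binom_sym[OF assms, of "2*m+1" "int m - 3*r - 1"] by (simp add: algebra_simps del: gauss_binom.simps)
  moreover have "6*(- r - 1)^2 + 7*(- r - 1) + 2 = 6*r^2 + 5*r + 1" for r :: int
    by (simp add: power2_eq_square algebra_simps)
  moreover have "6*(- r)^2 + - r = 6*r^2 - r" for r :: int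
    by simp
  ultimately have "((\<lambda>r. q powi (6*r^2 - r) * gauss_binom q (2*m + 1) (int m + 1 - 3*r)
      - q powi (6*r^2 + 5*r + 1) * gauss_binom q (2*m + 1) (int m - 3*r - 1)) has_sum 1) UNIV"
    by (simp only:)
  hence "((\<lambda>r. q ^ n * (q powi (6*r^2 - r) * gauss_binom q (2*m + 1) (int m + 1 - 3*r)
      - q powi (6*r^2 + 5*r + 1) * gauss_binom q (2*m + 1) (int m - 3*r - 1))) has_sum (q ^ n * 1)) UNIV"
    by (rule has_sum_cmult_right)
  moreover have "q ^ n * (q powi (6*r^2 - r) * gauss_binom q (2*m + 1) (int m + 1 - 3*r)
      - q powi (6*r^2 + 5*r + 1) * gauss_binom q (2*m + 1) (int m - 3*r - 1))
     = q powi (6*r^2 + 2*r) * gauss_binom q (2*n) (int n - 3*r)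
             - q powi (6*r^2 + 2*r) * gauss_binom q (2*n) (int n - 3*r - 1)" for r
  proof -
    have 1: "gauss_binom q (2*n) (int n - 3*r)
        = q powi (int n - 3*r) * gauss_binom q (2*m+1) (int m + 1 - 3*r) + gauss_binom q (2*m+1) (int m - 3*r)"
      unfolding Suc by (simp add: algebra_simps del: gauss_binom.simps) (simp add: algebra_simps)
    have 2: "gauss_binom q (2*n) (int n - 3*r - 1)
        = gauss_binom q (2*m+1) (int m - 3*r) + q powi (int n + 3*r + 1) * gauss_binom q (2*m+1) (int m - 3*r - 1)"
      using gauss_binom_Suc'[OF assms, of "2*m+1" "int m - 3*r"]
      by (simp add: Suc algebra_simps del: gauss_binom.simps)
    have 3: "q powi (6*r^2 + 2*r) * q powi (int n - 3*r) = q powi (int n) * q powi (6*r^2 - r)"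
      "q powi (6*r^2 + 2*r) * q powi (int n + 3*r + 1) = q powi (int n) * q powi (6*r^2 + 5*r + 1)"
      using assms by (intro power_int_mult_eq; simp)+
    show ?thesis
      unfolding 1 2 distrib_left right_diff_distrib mult.assoc[symmetric] 3 power_int_of_nat
      by simp
  qed
  ultimately show ?thesis by (simp del: gauss_binom.simps)
qed

lemma slater_A5:
  fixes q :: complex
  assumes "q \<noteq> 0"
  shows "((\<lambda>r. q powi (3*r^2 - r) * gauss_binom q (2*n) (int n - 3*r)
             - q powi (3*r^2 + r) * gauss_binom q (2*n) (int n - 3*r - 1)) has_sum q ^ n\<^sup>2) UNIV"
proof -
  \<comment> \<open>For \<open>k = int n - s\<close>, \<open>k * (k - 2 * int n)\<close> is
    \<open>s^2 - n^2\<close>. The factor \<open>q^(n^2)\<close> thus removes \<open>n\<close>, and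
    an exponent \<open>e\<close> becomes \<open>s^2 - e\<close>, with \<open>s = 3r\<close> or
    \<open>s = 3r + 1\<close>.\<close>
  have inv: "q powi (int n ^ 2) * (inverse q powi e * gauss_binom (inverse q) (2*n) k)
      = q powi (int n ^ 2 - e + k * (k - 2 * int n)) * gauss_binom q (2*n) k" for e k
    using assms by (simp add: gauss_binom_inverse power_int_add power_int_diff power_int_inverse divide_inverse mult_ac)
  have "((\<lambda>r. q powi (int n ^ 2) * (inverse q powi (6*r^2 + r) * gauss_binom (inverse q) (2*n) (int n - 3*r)
             - inverse q powi (6*r^2 + 5*r + 1) * gauss_binom (inverse q) (2*n) (int n - 3*r - 1)))
     has_sum (q powi (int n ^ 2) * 1)) UNIV"
    using assms by (intro has_sum_cmult_right slater_A1) auto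
  moreover have "int n ^ 2 - (6*r^2 + r) + (int n - 3*r) * (int n - 3*r - 2 * int n) = 3*r^2 - r" for r
    by (simp add: power2_eq_square algebra_simps)
  moreover have "int n ^ 2 - (6*r^2 + 5*r + 1) + (int n - 3*r - 1) * (int n - 3*r - 1 - 2 * int n) = 3*r^2 + r" for r
    by (simp add: power2_eq_square algebra_simps)
  ultimately show ?thesis
    unfolding right_diff_distrib inv
    by (simp only: mult_1_right) (simp add: power_int_of_nat flip: of_nat_power)
qed

lemma slater_A7:
  fixes q :: complex
  assumes "q \<noteq> 0"
  shows "((\<lambda>r. q powi (3*r^2 - 2*r) * gauss_binom q (2*n) (int n - 3*r)
             - q powi (3*r^2 + 4*r + 1) * gauss_binom q (2*n) (int n - 3*r - 1)) has_sum q ^ (n\<^sup>2 - n)) UNIV"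
proof -
  have inv: "q powi (int n ^ 2) * (inverse q powi e * gauss_binom (inverse q) (2*n) k)
      = q powi (int n ^ 2 - e + k * (k - 2 * int n)) * gauss_binom q (2*n) k" for e k
    using assms by (simp add: gauss_binom_inverse power_int_add power_int_diff power_int_inverse divide_inverse mult_ac)
  have "((\<lambda>r. q powi (int n ^ 2) * (inverse q powi (6*r^2 + 2*r) * gauss_binom (inverse q) (2*n) (int n - 3*r)
             - inverse q powi (6*r^2 + 2*r) * gauss_binom (inverse q) (2*n) (int n - 3*r - 1)))
     has_sum (q powi (int n ^ 2) * inverse q ^ n)) UNIV"
    using assms by (intro has_sum_cmult_right slater_A3) auto
  moreover have "int n ^ 2 - (6*r^2 + 2*r) + (int n - 3*r) * (int n - 3*r - 2 * int n) = 3*r^2 - 2*r" for r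
    by (simp add: power2_eq_square algebra_simps)
  moreover have "int n ^ 2 - (6*r^2 + 2*r) + (int n - 3*r - 1) * (int n - 3*r - 1 - 2 * int n) = 3*r^2 + 4*r + 1" for r
    by (simp add: power2_eq_square algebra_simps)
  moreover have "q powi (int n ^ 2) * inverse q ^ n = q ^ (n\<^sup>2 - n)"
  proof -
    have "n \<le> n\<^sup>2" by (simp add: power2_eq_square)
    thus ?thesis
      using assms by (simp add: power_diff power_int_of_nat field_simps flip: of_nat_power)
  qed
  ultimately show ?thesis
    unfolding right_diff_distrib inv by (simp only:)
qed

lemma gauss_binom_top [simp]: "gauss_binom q m (int m) = 1"
  by (induction m) (auto simp: gauss_binom_outside)

lemma gauss_binom_zero_right [simp]: "gauss_binom q m 0 = 1"
  by (induction m) (auto simp: gauss_binom_outside)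

text \<open>The quotient formula with denominators cleared. The step is the Pascal rule combined
  with \<open>q^i (1 - q^j) + (1 - q^i) = 1 - q^(i+j)\<close>.\<close>

lemma gauss_binom_qfac:
  "i + j = m \<Longrightarrow> gauss_binom q m (int i) * (qfac q q i * qfac q q j) = qfac q q m"
proof (induction m arbitrary: i j)
  case 0
  then show ?case by simp
next
  case (Suc m)
  show ?case
  proof (cases "i = 0 \<or> j = 0")
    case True
    with Suc.prems show ?thesis by (auto simp del: gauss_binom.simps simp flip: of_nat_Suc)
  next
    case False
    then obtain i' j' where ij: "i = Suc i'" "j = Suc j'"
      by (meson not0_implies_Suc)
    have m: "m = Suc (i' + j')" using Suc.prems ij by simp
    have IH: "gauss_binom q m (int (Suc i')) * (qfac q q (Suc i') * qfac q q j') = qfac q q m"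
      "gauss_binom q m (int i') * (qfac q q i' * qfac q q (Suc j')) = qfac q q m"
      by (rule Suc.IH; simp add: m)+
    have 1: "gauss_binom q (Suc m) (int i)
        = q ^ Suc i' * gauss_binom q m (int (Suc i')) + gauss_binom q m (int i')"
      unfolding ij gauss_binom.simps power_int_of_nat by simp
    show ?thesis
    proof -
      have "gauss_binom q (Suc m) (int i) * (qfac q q i * qfac q q j)
          = q ^ Suc i' * (1 - q * q ^ j') * (gauss_binom q m (int (Suc i')) * (qfac q q (Suc i') * qfac q q j'))
            + (1 - q * q ^ i') * (gauss_binom q m (int i') * (qfac q q i' * qfac q q (Suc j')))"
        unfolding 1 unfolding ij qfac_Suc by (simp only: distrib_left distrib_right mult_ac)
      also have "\<dots> = qfac q q (Suc m)"
        unfolding IH by (simp add: qfac_Suc m power_add algebra_simps)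
      finally show ?thesis .
    qed
  qed
qed

text \<open>The kernel \<open>c n r\<close> of Bailey pairs relative to 1. The explicit 0 encodes
  the convention \<open>1/(q)_k = 0\<close> for negative \<open>k\<close>, which \<open>nat\<close>
  would destroy.\<close>

definition bailey_coeff :: "complex \<Rightarrow> nat \<Rightarrow> int \<Rightarrow> complex" where
  "bailey_coeff q n r = (if \<bar>r\<bar> \<le> int n
     then 1 / (qfac q q (nat (int n - r)) * qfac q q (nat (int n + r))) else 0)"

lemma gauss_binom_bailey_coeff:
  assumes "norm q < 1"
  shows "gauss_binom q (2 * n) (int n - r) = qfac q q (2 * n) * bailey_coeff q n r"
proof (cases "\<bar>r\<bar> \<le> int n")
  case True
  have "gauss_binom q (2*n) (int (nat (int n - r))) *
      (qfac q q (nat (int n - r)) * qfac q q (nat (int n + r))) = qfac q q (2*n)"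
    using True by (intro gauss_binom_qfac) linarith
  moreover have "int (nat (int n - r)) = int n - r"
    using True by simp
  ultimately have "gauss_binom q (2*n) (int n - r) *
      (qfac q q (nat (int n - r)) * qfac q q (nat (int n + r))) = qfac q q (2*n)"
    by (simp only:)
  thus ?thesis
    using True qfac_base_nonzero[OF assms] by (simp add: bailey_coeff_def field_simps)
next
  case False
  thus ?thesis by (auto simp: bailey_coeff_def intro!: gauss_binom_outside)
qed

text \<open>\<open>slater_A5\<close> minus \<open>slater_A7\<close>, divided by
  \<open>(q)_2n\<close>. Corresponding exponents differ by \<open>r\<close>, \<open>3r + 1\<close>
  and \<open>n\<close>, whence the three factors of the form \<open>q^e - 1\<close>.\<close>

lemma bailey_pair:
  assumes "0 < norm q" "norm q < 1"
  shows "((\<lambda>r. q powi (3*r^2 - 2*r) * (q powi r - 1) * bailey_coeff q n (3*r)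
             + q powi (3*r^2 + r) * (q powi (3*r + 1) - 1) * bailey_coeff q n (3*r + 1))
     has_sum q ^ (n\<^sup>2 - n) * (q ^ n - 1) / qfac q q (2*n)) UNIV"
proof -
  have q: "q \<noteq> 0" using assms by auto
  have g: "gauss_binom q (2*n) (int n - 3*r) = qfac q q (2*n) * bailey_coeff q n (3*r)"
      "gauss_binom q (2*n) (int n - 3*r - 1) = qfac q q (2*n) * bailey_coeff q n (3*r+1)" for r
    using gauss_binom_bailey_coeff[OF assms(2), of n "3*r"] 
      gauss_binom_bailey_coeff[OF assms(2), of n "3*r+1"] by (simp_all add: algebra_simps)
  have "((\<lambda>r. (1 / qfac q q (2*n)) * ((q powi (3*r^2 - r) * gauss_binom q (2*n) (int n - 3*r)
             - q powi (3*r^2 + r) * gauss_binom q (2*n) (int n - 3*r - 1))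
          - (q powi (3*r^2 - 2*r) * gauss_binom q (2*n) (int n - 3*r)
             - q powi (3*r^2 + 4*r + 1) * gauss_binom q (2*n) (int n - 3*r - 1))))
      has_sum ((1 / qfac q q (2*n)) * (q ^ n\<^sup>2 - q ^ (n\<^sup>2 - n)))) UNIV"
    by (intro has_sum_cmult_right has_sum_diff_complex slater_A5 slater_A7 q)
  moreover have "(1 / qfac q q (2*n)) * ((q powi (3*r^2 - r) * gauss_binom q (2*n) (int n - 3*r)
             - q powi (3*r^2 + r) * gauss_binom q (2*n) (int n - 3*r - 1))
          - (q powi (3*r^2 - 2*r) * gauss_binom q (2*n) (int n - 3*r)
             - q powi (3*r^2 + 4*r + 1) * gauss_binom q (2*n) (int n - 3*r - 1)))
      = q powi (3*r^2 - 2*r) * (q powi r - 1) * bailey_coeff q n (3*r)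
             + q powi (3*r^2 + r) * (q powi (3*r + 1) - 1) * bailey_coeff q n (3*r + 1)" for r
  proof -
    have e: "q powi (3*r^2 - r) = q powi (3*r^2 - 2*r) * q powi r"
      "q powi (3*r^2 + 4*r + 1) = q powi (3*r^2 + r) * q powi (3*r + 1)"
      using q by (intro power_int_mult_eq'[symmetric]; simp)+
    show ?thesis
      unfolding g e using qfac_base_nonzero[OF assms(2), of "2*n"] by (simp add: field_simps)
  qed
  moreover have "(1 / qfac q q (2*n)) * (q ^ n\<^sup>2 - q ^ (n\<^sup>2 - n))
      = q ^ (n\<^sup>2 - n) * (q ^ n - 1) / qfac q q (2*n)"
  proof -
    have "q ^ n\<^sup>2 = q ^ (n\<^sup>2 - n) * q ^ n"
      by (simp add: power2_eq_square flip: power_add)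
    thus ?thesis by (simp add: field_simps)
  qed
  ultimately show ?thesis by (simp only:)
qed

subsection \<open>The finite Bailey lemma\<close>

lemma bailey_coeff_uminus: "bailey_coeff q n (- r) = bailey_coeff q n r"
  by (simp add: bailey_coeff_def mult.commute)

lemma bailey_coeff_of_nat:
  "bailey_coeff q (r + k) (int r) = 1 / (qfac q q k * qfac q q (2 * r + k))"
proof -
  have "nat (int (r + k) - int r) = k" "nat (int (r + k) + int r) = 2 * r + k"
    by auto
  thus ?thesis
    by (simp only: bailey_coeff_def) simp
qed

lemma sum_atMost_drop_zeros:
  fixes f :: "nat \<Rightarrow> 'a::comm_monoid_add"
  assumes "\<And>i. i < r \<Longrightarrow> f i = 0"
  shows "(\<Sum>i\<le>r + m. f i) = (\<Sum>k\<le>m. f (r + k))"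
proof (induction m)
  case 0
  have "(\<Sum>i\<in>insert r {..<r}. f i) = f r"
    using assms by (subst sum.insert) auto
  thus ?case by (simp flip: lessThan_Suc_atMost lessThan_Suc)
qed simp_all

section \<open>Negative orders and the well-poised factor\<close>

lemma qpoch_qfac: "norm q < 1 \<Longrightarrow> qpoch a q (int n) = qfac q a n"
  by (simp add: qpoch_of_nat qfac_def)

text \<open>After reversal of the product each factor is
  \<open>1 - a q^(-k-1) = a (-1/q^(k+1)) (1 - (q/a) q^k)\<close>. The product of the
  \<open>-1/q^(k+1)\<close> stays unevaluated, since it does not depend on \<open>a\<close> and
  cancels in quotients.\<close>

lemma qpoch_uminus_qfac:
  assumes "0 < norm q" "norm q < 1" "a \<noteq> 0"
  shows "qpoch a q (- int n) = 1 / (a ^ n * (\<Prod>k<n. - 1 / q ^ Suc k) * qfac q (q / a) n)"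
proof -
  have q: "q \<noteq> 0" using assms by auto
  have "(\<Prod>k<n. 1 - (a * q powi (- int n)) * q ^ k) = (\<Prod>k<n. 1 - (a * q powi (- int n)) * q ^ (n - Suc k))"
    by (rule prod.nat_diff_reindex[symmetric])
  also have "\<dots> = (\<Prod>k<n. a * (- 1 / q ^ Suc k) * (1 - q / a * q ^ k))"
  proof (rule prod.cong[OF refl])
    fix k assume "k \<in> {..<n}"
    hence "n = (n - Suc k) + Suc k"
      by simp
    hence "q ^ n = q ^ (n - Suc k) * q ^ Suc k"
      by (metis power_add)
    thus "1 - (a * q powi (- int n)) * q ^ (n - Suc k) = a * (- 1 / q ^ Suc k) * (1 - q / a * q ^ k)"
      using q assms(3) by (simp add: power_int_minus field_simps)
  qed
  also have "\<dots> = a ^ n * (\<Prod>k<n. - 1 / q ^ Suc k) * qfac q (q / a) n"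
    by (simp only: prod.distrib qfac_def prod_constant card_lessThan)
  finally show ?thesis
    using qpoch_minus_of_nat[OF assms(1,2), of a n] by simp
qed

text \<open>The factor \<open>\<rho>(r)\<close> of the overview; the power of \<open>q/(xy)\<close>
  makes it even in \<open>r\<close> for nonzero \<open>x\<close> and \<open>y\<close>.\<close>

definition well_poised :: "complex \<Rightarrow> complex \<Rightarrow> complex \<Rightarrow> int \<Rightarrow> complex" where
  "well_poised q x y r = (qpoch x q r * qpoch y q r) / (qpoch (q / x) q r * qpoch (q / y) q r)
     * (q / (x * y)) powi r"

text \<open>
  If \<open>x = q powi (- m)\<close>, both sides vanish for \<open>n > m\<close>: the left-hand one by \<open>c / 0 = 0\<close>, the
  right-hand one because of a zero factor in \<open>qpoch x q (int n)\<close>.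
\<close>

lemma qpoch_ratio_uminus:
  assumes "0 < norm q" "norm q < 1" "x \<noteq> 0"
  shows "qpoch x q (- int n) / qpoch (q / x) q (- int n)
     = (q / x ^ 2) ^ n * (qpoch x q (int n) / qpoch (q / x) q (int n))"
proof -
  have q: "q \<noteq> 0" using assms by auto
  have qx0: "q / x \<noteq> 0" using q assms(3) by auto
  have qx: "q / (q / x) = x"
    using q by simp
  note 1 = qpoch_uminus_qfac[OF assms(1,2) qx0, of n, unfolded qx]
  have "(\<Prod>k<n. - 1 / q ^ Suc k) \<noteq> 0"
    using q by auto
  thus ?thesis
    unfolding 1 qpoch_uminus_qfac[OF assms, of n] qpoch_qfac[OF assms(2)] using q assms(3)
    by (simp add: power_divide power2_eq_square power_mult_distrib)
qed

text \<open>The reflection factors \<open>(q/x^2)^n\<close> and \<open>(q/y^2)^n\<close> multiply to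
  \<open>(q/(xy))^(2n)\<close>, exactly what converts the power of order \<open>-n\<close> into that
  of order \<open>n\<close>.\<close>

lemma well_poised_uminus_of_nat:
  assumes "0 < norm q" "norm q < 1" "x \<noteq> 0" "y \<noteq> 0"
  shows "well_poised q x y (- int n) = well_poised q x y (int n)"
proof -
  have q: "q \<noteq> 0" using assms by auto
  have "well_poised q x y (- int n) = (qpoch x q (- int n) / qpoch (q / x) q (- int n))
     * (qpoch y q (- int n) / qpoch (q / y) q (- int n)) * (q / (x * y)) powi (- int n)"
    by (simp add: well_poised_def)
  also have "\<dots> = ((q / x ^ 2) ^ n * (q / y ^ 2) ^ n * (q / (x * y)) powi (- int n)) *
      ((qpoch x q (int n) / qpoch (q / x) q (int n)) * (qpoch y q (int n) / qpoch (q / y) q (int n)))"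
    unfolding qpoch_ratio_uminus[OF assms(1,2,3)] qpoch_ratio_uminus[OF assms(1,2,4)]
    by (simp add: mult_ac)
  also have "(q / x ^ 2) ^ n * (q / y ^ 2) ^ n * (q / (x * y)) powi (- int n) = (q / (x * y)) ^ n"
    using q assms(3,4)
    by (simp add: power_int_minus power_divide power_mult_distrib power2_eq_square field_simps)
  finally show ?thesis
    by (simp add: well_poised_def mult_ac)
qed

lemma well_poised_abs:
  assumes "0 < norm q" "norm q < 1" "x \<noteq> 0" "y \<noteq> 0"
  shows "well_poised q x y r = well_poised q x y (int (nat \<bar>r\<bar>))"
  by (cases r rule: int_cases2) (simp_all add: well_poised_uminus_of_nat[OF assms])

definition bailey_weight :: "complex \<Rightarrow> complex \<Rightarrow> complex \<Rightarrow> nat \<Rightarrow> nat \<Rightarrow> complex" where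
  "bailey_weight q x y N n = qfac q x n * qfac q y n * qfac q (q / (x * y)) (N - n)
     * (q / (x * y)) ^ n / qfac q q (N - n)"

text \<open>Only \<open>n = r + k\<close> contributes. Up to the constant \<open>c\<close> this is
  the q-Pfaff--Saalschuetz sum with \<open>a = x q^r\<close>, \<open>b = y q^r\<close>,
  \<open>d = q/(xy)\<close>; here \<open>a b d = q^(2r+1)\<close>, which fits
  \<open>(q)_(2r+k) = (q)_2r (q^(2r+1))_k\<close>.\<close>

lemma bailey_weight_sum_nat:
  assumes "0 < norm q" "norm q < 1" "x \<noteq> 0" "y \<noteq> 0"
    and nz: "\<And>n. qfac q (q / x) n \<noteq> 0" "\<And>n. qfac q (q / y) n \<noteq> 0"
  shows "(\<Sum>n\<le>r + m. bailey_weight q x y (r + m) n * bailey_coeff q n (int r))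
     = qfac q (q / x) (r + m) * qfac q (q / y) (r + m) * bailey_coeff q (r + m) (int r)
       * well_poised q x y (int r)"
proof -
  define d where "d = q / (x * y)"
  define a b where "a = x * q ^ r" and "b = y * q ^ r"
  define c where "c = qfac q x r * qfac q y r * d ^ r / qfac q q (2 * r)"
  have q: "q \<noteq> 0" using assms by auto
  have abd: "a * b * d = q * q ^ (2 * r)" "a * d = q / y * q ^ r" "b * d = q / x * q ^ r"
    using assms q by (simp_all add: a_def b_def d_def mult_2 power_add)
  have nz': "qfac q (a * b * d) n \<noteq> 0" for n
    using qfac_base_power_nonzero[OF assms(2), of "Suc (2 * r)"] by (simp add: abd)
  have "(\<Sum>n\<le>r + m. bailey_weight q x y (r + m) n * bailey_coeff q n (int r))
      = (\<Sum>k\<le>m. bailey_weight q x y (r + m) (r + k) * bailey_coeff q (r + k) (int r))"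
    by (rule sum_atMost_drop_zeros) (simp add: bailey_coeff_def)
  also have "\<dots> = (\<Sum>k\<le>m. c * saalschutz_term q a b d m k)"
  proof (rule sum.cong[OF refl])
    fix k
    have "r + m - (r + k) = m - k" by simp
    thus "bailey_weight q x y (r + m) (r + k) * bailey_coeff q (r + k) (int r) = c * saalschutz_term q a b d m k"
      unfolding bailey_coeff_of_nat bailey_weight_def saalschutz_term_def abd c_def
      by (simp add: qfac_add power_add mult_ac flip: d_def a_def b_def)
  qed
  also have "\<dots> = c * (qfac q (a * d) m * qfac q (b * d) m / (qfac q q m * qfac q (a * b * d) m))"
    unfolding sum_distrib_left[symmetric] q_pfaff_saalschutz[OF qfac_base_nonzero[OF assms(2)] nz'] ..
  also have "\<dots> = qfac q (q / x) (r + m) * qfac q (q / y) (r + m) * bailey_coeff q (r + m) (int r)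
       * well_poised q x y (int r)"
    unfolding bailey_coeff_of_nat well_poised_def qpoch_qfac[OF assms(2)] abd c_def qfac_add
      power_int_of_nat d_def[symmetric]
    using nz[of r] by (simp add: mult_ac)
  finally show ?thesis .
qed

text \<open>Both sides are even in \<open>r\<close>, and both vanish for
  \<open>\<bar>r\<bar> > N\<close>.\<close>

lemma bailey_weight_sum:
  assumes "0 < norm q" "norm q < 1" "x \<noteq> 0" "y \<noteq> 0"
    and "\<And>n. qfac q (q / x) n \<noteq> 0" "\<And>n. qfac q (q / y) n \<noteq> 0"
  shows "(\<Sum>n\<le>N. bailey_weight q x y N n * bailey_coeff q n r)
     = qfac q (q / x) N * qfac q (q / y) N * bailey_coeff q N r * well_poised q x y r"
proof -
  have abs: "bailey_coeff q n r = bailey_coeff q n (int (nat \<bar>r\<bar>))" for n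
    by (cases r rule: int_cases2) (simp_all add: bailey_coeff_uminus)
  show ?thesis
  proof (cases "nat \<bar>r\<bar> \<le> N")
    case True
    then obtain m where "N = nat \<bar>r\<bar> + m"
      using less_eqE by blast
    thus ?thesis
      unfolding abs well_poised_abs[OF assms(1-4), of r]
      using bailey_weight_sum_nat[OF assms, of "nat \<bar>r\<bar>" m] by (simp only:)
  next
    case False
    thus ?thesis
      by (simp add: bailey_coeff_def)
  qed
qed

subsection \<open>The limit\<close>

text \<open>Dominated convergence for series: the majorant makes the partial sums converge uniformly
  in \<open>n\<close>, which permits the exchange of limits.\<close>

lemma tannery:
  fixes f :: "nat \<Rightarrow> 'a \<Rightarrow> complex"
  assumes "\<And>n x. norm (f n x) \<le> M x" "M summable_on A" "\<And>x. (\<lambda>n. f n x) \<longlonglongrightarrow> g x"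
  shows "(\<lambda>n. infsum (f n) A) \<longlonglongrightarrow> infsum g A" and "g summable_on A"
proof -
  have "norm (g x) \<le> M x" for x
    by (rule Lim_bounded[OF tendsto_norm[OF assms(3)]]) (use assms(1) in auto)
  from abs_summable_summable[OF Infinite_Sum.abs_summable_on_comparison_test'[OF assms(2) this]]
  show g: "g summable_on A" .
  show "(\<lambda>n. infsum (f n) A) \<longlonglongrightarrow> infsum g A"
  proof (rule swap_uniform_limit')
    show "uniform_limit UNIV (\<lambda>X n. \<Sum>x\<in>X. f n x) (\<lambda>n. infsum (f n) A) (finite_subsets_at_top A)"
      using Weierstrass_m_test_general[of A UNIV "\<lambda>x n. f n x" M] assms(1,2) by simp
    show "((\<lambda>X. sum g X) \<longlongrightarrow> infsum g A) (finite_subsets_at_top A)"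
      using g by (simp add: infsum_tendsto)
    show "\<forall>\<^sub>F X in finite_subsets_at_top A. (\<lambda>n. \<Sum>x\<in>X. f n x) \<longlonglongrightarrow> sum g X"
      by (intro always_eventually allI tendsto_sum assms(3))
  qed auto
qed

lemma has_sum_finite_sum:
  fixes f :: "'b \<Rightarrow> 'a \<Rightarrow> complex"
  assumes "finite I" "\<And>i. i \<in> I \<Longrightarrow> (f i has_sum s i) A"
  shows "((\<lambda>x. \<Sum>i\<in>I. f i x) has_sum (\<Sum>i\<in>I. s i)) A"
  using assms by (induction I rule: finite_induct) (auto intro!: has_sum_add)

section \<open>Convergence and bounds for the factors\<close>

lemma convergent_prod_qfac:
  fixes a q :: complex
  assumes "norm q < 1"
  shows "convergent_prod (\<lambda>k. 1 - a * q ^ k)"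
proof -
  have "summable (\<lambda>k. norm a * norm q ^ k)"
    using assms by (intro summable_mult summable_geometric) auto
  thus ?thesis
    by (intro abs_convergent_prod_imp_convergent_prod)
       (simp add: abs_convergent_prod_conv_summable norm_mult norm_power)
qed

lemma qfac_tendsto:
  assumes "norm q < 1"
  shows "(\<lambda>n. qfac q a n) \<longlonglongrightarrow> qpoch_inf a q"
proof -
  have "(\<lambda>k. 1 - a * q ^ k) has_prod qpoch_inf a q"
    unfolding qpoch_inf_def by (rule convergent_prod_has_prod[OF convergent_prod_qfac[OF assms]])
  thus ?thesis
    unfolding qfac_def by (rule has_prod_imp_tendsto')
qed

lemma qpoch_inf_nonzero:
  assumes "norm q < 1" "\<And>n. qfac q a n \<noteq> 0"
  shows "qpoch_inf a q \<noteq> 0"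
proof -
  have "1 - a * q ^ n \<noteq> 0" for n
    using assms(2)[of "Suc n"] by (auto simp: qfac_Suc)
  thus ?thesis
    unfolding qpoch_inf_def by (intro prodinf_nonzero convergent_prod_qfac assms)
qed

lemma qfac_bounded:
  assumes "norm q < 1"
  obtains C where "C > 0" "\<And>n. norm (qfac q a n) \<le> C"
  using convergent_imp_Bseq[OF convergentI[OF qfac_tendsto[OF assms, of a]]]
  by (auto simp: Bseq_def)

text \<open>The limit is a convergent product without zero factors, hence non-zero, so the
  reciprocals converge.\<close>

lemma inverse_qfac_bounded:
  assumes "norm q < 1" "\<And>n. qfac q a n \<noteq> 0"
  obtains C where "C > 0" "\<And>n. norm (1 / qfac q a n) \<le> C"
proof -
  have "(\<lambda>n. 1 / qfac q a n) \<longlonglongrightarrow> 1 / qpoch_inf a q"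
    by (intro tendsto_intros qfac_tendsto qpoch_inf_nonzero assms)
  from convergent_imp_Bseq[OF convergentI[OF this]] that show ?thesis
    by (auto simp: Bseq_def)
qed

text \<open>The term is \<open>(t^(n-1) c)^n\<close>, eventually below \<open>(1/2)^n\<close>
  however large \<open>c\<close> is. This makes the limit independent of the size of
  \<open>q/(xy)\<close>.\<close>

lemma summable_theta:
  fixes t c :: real
  assumes "0 \<le> t" "t < 1" "0 \<le> c"
  shows "summable (\<lambda>n. t ^ (n\<^sup>2 - n) * c ^ n)"
proof -
  have "(\<lambda>n. t ^ n * (t * c)) \<longlonglongrightarrow> 0 * (t * c)"
    by (intro tendsto_intros LIMSEQ_realpow_zero assms)
  hence "\<forall>\<^sub>F n in sequentially. t ^ n * (t * c) < 1 / 2"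
    by (rule order_tendstoD) simp
  then obtain n0 where n0: "\<And>n. n \<ge> n0 \<Longrightarrow> t ^ n * (t * c) < 1 / 2"
    by (auto simp: eventually_sequentially)
  show ?thesis
  proof (rule summable_comparison_test)
    show "\<exists>N. \<forall>n\<ge>N. norm (t ^ (n\<^sup>2 - n) * c ^ n) \<le> (1 / 2) ^ n"
    proof (intro exI allI impI)
      \<comment> \<open>With \<open>n = k + 2\<close> the base \<open>t^(n-1) c\<close> is
        \<open>t^k (t c)\<close>, the quantity controlled by \<open>n0\<close>.\<close>
      fix n assume n: "n \<ge> n0 + 2"
      obtain k where k: "n = k + 2" using n by (metis add.commute le_add2 le_trans less_eqE)
      have "n\<^sup>2 - n = (n - 1) * n"
        by (simp add: power2_eq_square algebra_simps)
      also have "n - 1 = k + 1" using k by simp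
      finally have "t ^ (n\<^sup>2 - n) * c ^ n = (t ^ (k + 1)) ^ n * c ^ n"
        by (simp only: power_mult)
      also have "\<dots> = (t ^ k * (t * c)) ^ n"
        by (simp add: power_mult_distrib mult_ac)
      also have "\<dots> \<le> (1 / 2) ^ n"
        using n0[of k] n k assms by (intro power_mono) auto
      finally show "norm (t ^ (n\<^sup>2 - n) * c ^ n) \<le> (1 / 2) ^ n"
        using assms by simp
    qed
  qed auto
qed

lemma summable_on_int_nat_abs:
  fixes s :: "nat \<Rightarrow> real"
  assumes "s summable_on UNIV"
  shows "(\<lambda>r::int. s (nat \<bar>r\<bar>)) summable_on UNIV"
proof -
  have 1: "(\<lambda>r::int. s (nat \<bar>r\<bar>)) summable_on range int"
    using assms by (subst summable_on_reindex) (auto simp: o_def)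
  have 2: "(\<lambda>r::int. s (nat \<bar>r\<bar>)) summable_on range (\<lambda>n. - int n)"
    using assms by (subst summable_on_reindex) (auto simp: o_def inj_on_def)
  have "r \<in> range int \<union> range (\<lambda>n. - int n)" for r
    by (cases r rule: int_cases2) auto
  hence "range int \<union> range (\<lambda>n. - int n) = UNIV" by blast
  with summable_on_union[OF 1 2] show ?thesis by simp
qed

lemma bailey_coeff_tendsto:
  assumes "norm q < 1"
  shows "(\<lambda>N. bailey_coeff q N r) \<longlonglongrightarrow> 1 / (qpoch_inf q q * qpoch_inf q q)"
proof -
  have lim: "(\<lambda>N. qfac q q (nat (int N + c))) \<longlonglongrightarrow> qpoch_inf q q" for c
  proof (rule filterlim_compose[OF qfac_tendsto[OF assms]])
    show "filterlim (\<lambda>N. nat (int N + c)) sequentially sequentially"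
      unfolding filterlim_at_top
    proof
      fix Z
      show "\<forall>\<^sub>F N in sequentially. Z \<le> nat (int N + c)"
        using eventually_ge_at_top[of "Z + nat \<bar>c\<bar>"] by eventually_elim linarith
    qed
  qed
  have "(\<lambda>N. 1 / (qfac q q (nat (int N + (- r))) * qfac q q (nat (int N + r))))
      \<longlonglongrightarrow> 1 / (qpoch_inf q q * qpoch_inf q q)"
    using qpoch_inf_nonzero[OF assms qfac_base_nonzero[OF assms]]
    by (intro tendsto_intros lim) auto
  moreover have "\<forall>\<^sub>F N in sequentially.
      1 / (qfac q q (nat (int N + (- r))) * qfac q q (nat (int N + r))) = bailey_coeff q N r"
    using eventually_ge_at_top[of "nat \<bar>r\<bar>"]
    by eventually_elim (simp add: bailey_coeff_def nat_le_iff)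
  ultimately show ?thesis
    by (rule Lim_transform_eventually)
qed

lemma bailey_coeff_bounded:
  assumes "norm q < 1"
  obtains C where "C > 0" "\<And>n r. norm (bailey_coeff q n r) \<le> C"
proof -
  obtain C where C: "C > 0" "\<And>n. norm (1 / qfac q q n) \<le> C"
    using inverse_qfac_bounded[OF assms qfac_base_nonzero[OF assms]] by blast
  have "norm (bailey_coeff q n r) \<le> C * C" for n r
  proof (cases "\<bar>r\<bar> \<le> int n")
    case True
    hence "bailey_coeff q n r = (1 / qfac q q (nat (int n - r))) * (1 / qfac q q (nat (int n + r)))"
      by (simp add: bailey_coeff_def)
    thus ?thesis
      using C by (simp only: norm_mult) (intro mult_mono, auto)
  qed (use C in \<open>simp add: bailey_coeff_def\<close>)
  with that[of "C * C"] C(1) show ?thesis by auto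
qed

text \<open>Evenness reduces to natural order, where the factorials and the reciprocals are bounded;
  only the power of \<open>q/(xy)\<close> can grow.\<close>

lemma well_poised_bounded:
  assumes "0 < norm q" "norm q < 1" "x \<noteq> 0" "y \<noteq> 0"
    and "\<And>n. qfac q (q / x) n \<noteq> 0" "\<And>n. qfac q (q / y) n \<noteq> 0"
  obtains C where "C > 0" "\<And>r. norm (well_poised q x y r) \<le> C * norm (q / (x * y)) ^ nat \<bar>r\<bar>"
proof -
  obtain C1 where C1: "C1 > 0" "\<And>n. norm (qfac q x n) \<le> C1"
    using qfac_bounded[OF assms(2)] by blast
  obtain C2 where C2: "C2 > 0" "\<And>n. norm (qfac q y n) \<le> C2"
    using qfac_bounded[OF assms(2)] by blast
  obtain C3 where C3: "C3 > 0" "\<And>n. norm (1 / qfac q (q / x) n) \<le> C3"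
    using inverse_qfac_bounded[OF assms(2,5)] by blast
  obtain C4 where C4: "C4 > 0" "\<And>n. norm (1 / qfac q (q / y) n) \<le> C4"
    using inverse_qfac_bounded[OF assms(2,6)] by blast
  have "norm (well_poised q x y r) \<le> (C1 * C2 * C3 * C4) * norm (q / (x * y)) ^ nat \<bar>r\<bar>" for r
  proof -
    let ?n = "nat \<bar>r\<bar>"
    have "well_poised q x y r = well_poised q x y (int ?n)"
      by (rule well_poised_abs[OF assms(1-4)])
    also have "\<dots> = qfac q x ?n * qfac q y ?n * (1 / qfac q (q / x) ?n) * (1 / qfac q (q / y) ?n)
        * (q / (x * y)) ^ ?n"
      unfolding well_poised_def qpoch_qfac[OF assms(2)] power_int_of_nat by simp
    finally have eq: "well_poised q x y r = \<dots>" .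
    show ?thesis
      unfolding eq norm_mult norm_power using C1 C2 C3 C4
      by (intro mult_mono order.refl mult_nonneg_nonneg norm_ge_zero zero_le_power) auto
  qed
  with that[of "C1 * C2 * C3 * C4"] C1(1) C2(1) C3(1) C4(1) show ?thesis by auto
qed

lemma norm_power_int_diff_le:
  fixes q :: complex
  assumes "0 < norm q" "norm q < 1" "e \<le> i" "e \<le> j"
  shows "norm (q powi i - q powi j) \<le> 2 * norm q powi e"
proof -
  have "norm q powi i \<le> norm q powi e" "norm q powi j \<le> norm q powi e"
    using assms by (intro power_int_decreasing; simp)+
  thus ?thesis
    using norm_triangle_ineq4[of "q powi i" "q powi j"] by (simp add: norm_power_int)
qed

text \<open>A factor \<open>1 - q^(k+1)/z\<close> vanishes only at \<open>z = q^(k+1)\<close>.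
  Applied to \<open>x\<close>, \<open>y\<close> and \<open>x * y\<close>.\<close>

lemma qfac_divide_nonzero:
  assumes "norm q < 1" "z \<noteq> 0" "\<And>m::nat. m \<ge> 1 \<Longrightarrow> z \<noteq> q ^ m"
  shows "qfac q (q / z) n \<noteq> 0"
  using assms(2) assms(3)[of "Suc _"] by (auto simp: qfac_def divide_simps)

lemma summable_on_theta_int:
  fixes t c :: real
  assumes "0 \<le> t" "t < 1" "0 \<le> c"
  shows "(\<lambda>r::int. t ^ ((nat \<bar>r\<bar>)\<^sup>2 - nat \<bar>r\<bar>) * c ^ nat \<bar>r\<bar>) summable_on UNIV"
  using assms summable_theta[OF assms]
  by (intro summable_on_int_nat_abs[of "\<lambda>n. t ^ (n\<^sup>2 - n) * c ^ n"])
     (simp add: summable_on_UNIV_nonneg_real_iff)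

text \<open>A common lower bound for the exponents in the coefficients, so that one theta-type
  majorant serves all. The case with \<open>4*r\<close> reduces to
  \<open>(2*\<bar>r\<bar> - 1) * (\<bar>r\<bar> - 1) \<ge> 0\<close>, the others to
  \<open>\<bar>r\<bar> \<le> r\<^sup>2\<close>.\<close>

lemma int_quadratic_bounds:
  fixes r :: int
  shows "r\<^sup>2 - \<bar>r\<bar> \<le> 3*r\<^sup>2 - r" "r\<^sup>2 - \<bar>r\<bar> \<le> 3*r\<^sup>2 - 2*r"
    "r\<^sup>2 - \<bar>r\<bar> \<le> 3*r\<^sup>2 + 4*r + 1" "r\<^sup>2 - \<bar>r\<bar> \<le> 3*r\<^sup>2 + r"
proof -
  have 1: "\<bar>r\<bar> \<le> r\<^sup>2"
    by (metis abs_le_square_iff abs_of_nonneg abs_ge_zero int_one_le_iff_zero_less linorder_not_less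
        mult_le_cancel_left1 order_refl power2_abs power2_eq_square zero_less_abs_iff)
  have 2: "0 \<le> (2 * \<bar>r\<bar> - 1) * (\<bar>r\<bar> - 1)"
    by (cases "r = 0") (auto intro!: mult_nonneg_nonneg)
  have 3: "(2 * \<bar>r\<bar> - 1) * (\<bar>r\<bar> - 1) = 2 * r\<^sup>2 - 3 * \<bar>r\<bar> + 1"
    by (simp add: power2_eq_square algebra_simps flip: abs_mult)
  show "r\<^sup>2 - \<bar>r\<bar> \<le> 3*r\<^sup>2 - r" "r\<^sup>2 - \<bar>r\<bar> \<le> 3*r\<^sup>2 - 2*r"
    "r\<^sup>2 - \<bar>r\<bar> \<le> 3*r\<^sup>2 + r"
    using 1 by arith+
  show "r\<^sup>2 - \<bar>r\<bar> \<le> 3*r\<^sup>2 + 4*r + 1"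
    using 2 unfolding 3 by arith
qed

text \<open>The excluded powers of \<open>q\<close> are the values at which some
  \<open>(q/x)_n\<close> or \<open>(q/y)_n\<close>, or \<open>(q/(xy))_inf\<close>, vanishes.
  Summability is claimed explicitly because \<open>infsum\<close> defaults to 0 on families that are
  not summable.\<close>

theorem theorem7:
  fixes q x y :: complex
  assumes "0 < norm q" and "norm q < 1"
    and "x \<noteq> 0" and "y \<noteq> 0"
    and "\<And>m::nat. m \<ge> 1 \<Longrightarrow> x \<noteq> q ^ m"
    and "\<And>m::nat. m \<ge> 1 \<Longrightarrow> y \<noteq> q ^ m"
    and "\<And>m::nat. m \<ge> 1 \<Longrightarrow> x * y \<noteq> q ^ m"
  shows "S1_term x y q summable_on UNIV \<and>
    S2_term x y q summable_on UNIV \<and>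
    (\<lambda>n::nat. (qpoch x q (int n) * qpoch y q (int n)) / qpoch q q (2 * int n)
              * (1 / (x * y)) ^ n * (q ^ n - 1) * q ^ (n\<^sup>2))
         sums ((S1 x y q - S2 x y q)
              * ((qpoch_inf (q / x) q * qpoch_inf (q / y) q)
                  / (qpoch_inf q q * qpoch_inf (q / (x * y)) q)))"
proof -
  define t where "t = norm q"
  define d where "d = q / (x * y)"
  \<comment> \<open>\<open>K \<ge> 1\<close> makes its powers increase, so the orders
    \<open>3r\<close> and \<open>3r + 1\<close>, of modulus at most
    \<open>3 * \<bar>r\<bar> + 1\<close>, share the bound
    \<open>K * (K ^ 3) ^ nat \<bar>r\<bar>\<close>.\<close>
  define K where "K = max 1 (norm d)"
  define \<theta> where "\<theta> r = t ^ ((nat \<bar>r\<bar>)\<^sup>2 - nat \<bar>r\<bar>) * (K ^ 3) ^ nat \<bar>r\<bar>" for r :: int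
  \<comment> \<open>\<open>a1 r\<close> and \<open>a2 r\<close> are \<open>a(3r)\<close> and
    \<open>a(3r+1)\<close> of the overview; \<open>\<beta>\<close> is the other side of the Bailey
    pair.\<close>
  define a1 where "a1 r = q powi (3*r^2 - 2*r) * (q powi r - 1)" for r :: int
  define a2 where "a2 r = q powi (3*r^2 + r) * (q powi (3*r + 1) - 1)" for r :: int
  define \<beta> where "\<beta> n = q ^ (n\<^sup>2 - n) * (q ^ n - 1) / qfac q q (2*n)" for n
  have q: "q \<noteq> 0" and t: "0 < t" "t < 1" and K: "K \<ge> 1" "norm d \<le> K"
    using assms by (auto simp: t_def K_def)
  have nzx: "qfac q (q / x) n \<noteq> 0" and nzy: "qfac q (q / y) n \<noteq> 0" and nzd: "qfac q d n \<noteq> 0" for n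
    unfolding d_def by (rule qfac_divide_nonzero; use assms in auto)+
  let ?Q = "qpoch_inf q q" and ?X = "qpoch_inf (q / x) q" and ?Y = "qpoch_inf (q / y) q"
    and ?D = "qpoch_inf d q"
  have Q: "?Q \<noteq> 0" and D: "?D \<noteq> 0"
    using assms(2) nzd by (simp_all add: qpoch_inf_nonzero qfac_base_nonzero)

  \<comment> \<open>The bilateral summands in terms of the Bailey pair\<close>
  have S1: "S1_term x y q r = a1 r * well_poised q x y (3*r)" for r
  proof -
    have "q powi (3*r\<^sup>2 + r) = q powi (3*r^2 - 2*r) * q powi (3*r)"
      using q by (intro power_int_mult_eq'[symmetric]) auto
    thus ?thesis
      by (simp add: S1_term_def a1_def well_poised_def power_int_divide_distrib)
  qed
  \<comment> \<open>The sign comes from \<open>1 - q powi (3*r + 1)\<close> against the opposite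
    difference in \<open>a2\<close>; hence \<open>S1 - S2\<close> collects both families with a plus
    sign.\<close>
  have S2: "S2_term x y q r = - (a2 r * well_poised q x y (3*r + 1))" for r
  proof -
    have "q powi (3*r\<^sup>2 + 4*r + 1) = q powi (3*r^2 + r) * q powi (3*r + 1)"
      using q by (intro power_int_mult_eq'[symmetric]) auto
    thus ?thesis
      by (simp add: S2_term_def a2_def well_poised_def power_int_divide_distrib)
         (simp add: divide_inverse algebra_simps)
  qed

  \<comment> \<open>Theta majorant and summability of both series\<close>
  obtain C where C: "C > 0" "\<And>r. norm (well_poised q x y r) \<le> C * norm d ^ nat \<bar>r\<bar>"
    unfolding d_def using well_poised_bounded[OF assms(1-4) nzx nzy] by blast
  have pos: "0 \<le> \<theta> r" for r
    using t K by (simp add: \<theta>_def)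
  have \<theta>: "\<theta> summable_on UNIV"
    unfolding \<theta>_def using t K by (intro summable_on_theta_int) auto
  have t_pow: "t ^ ((nat \<bar>r\<bar>)\<^sup>2 - nat \<bar>r\<bar>) = t powi (r\<^sup>2 - \<bar>r\<bar>)" for r
  proof -
    have "nat \<bar>r\<bar> \<le> (nat \<bar>r\<bar>)\<^sup>2"
      unfolding power2_eq_square by (rule le_square)
    hence "int ((nat \<bar>r\<bar>)\<^sup>2 - nat \<bar>r\<bar>) = r\<^sup>2 - \<bar>r\<bar>"
      by (simp add: of_nat_diff)
    thus ?thesis
      by (metis power_int_of_nat)
  qed
  have a1_bound: "norm (a1 r) \<le> 2 * t ^ ((nat \<bar>r\<bar>)\<^sup>2 - nat \<bar>r\<bar>)" for r
  proof -
    have "a1 r = q powi (3*r^2 - r) - q powi (3*r^2 - 2*r)"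
      using power_int_mult_eq'[OF q, of "3*r^2 - 2*r" r "3*r^2 - r"]
      by (simp add: a1_def right_diff_distrib)
    thus ?thesis
      unfolding t_pow unfolding t_def
      using norm_power_int_diff_le[OF assms(1,2) int_quadratic_bounds(1,2)[of r]] by simp
  qed
  have a2_bound: "norm (a2 r) \<le> 2 * t ^ ((nat \<bar>r\<bar>)\<^sup>2 - nat \<bar>r\<bar>)" for r
  proof -
    have "a2 r = q powi (3*r^2 + 4*r + 1) - q powi (3*r^2 + r)"
      using power_int_mult_eq'[OF q, of "3*r^2 + r" "3*r + 1" "3*r^2 + 4*r + 1"]
      by (simp add: a2_def right_diff_distrib)
    thus ?thesis
      unfolding t_pow unfolding t_def
      using norm_power_int_diff_le[OF assms(1,2) int_quadratic_bounds(3,4)[of r]] by simp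
  qed
  have wp_bound: "norm (well_poised q x y r) \<le> C * (K * (K ^ 3) ^ k)" if "nat \<bar>r\<bar> \<le> 3 * k + 1" for r k
  proof -
    have "norm d ^ nat \<bar>r\<bar> \<le> K ^ nat \<bar>r\<bar>"
      using K by (intro power_mono) auto
    also have "\<dots> \<le> K ^ (3 * k + 1)"
      using K that by (intro power_increasing) auto
    also have "\<dots> = K * (K ^ 3) ^ k"
      by (simp add: power_mult)
    finally show ?thesis
      using C by (meson mult_left_mono order.trans order_less_imp_le)
  qed
  define B where "B = 2 * C * K"
  have B: "B > 0" using C K by (simp add: B_def)
  have bound1: "norm (a1 r * well_poised q x y (3*r)) \<le> B * \<theta> r" for r
  proof -
    have "norm (a1 r * well_poised q x y (3*r))
        \<le> (2 * t ^ ((nat \<bar>r\<bar>)\<^sup>2 - nat \<bar>r\<bar>)) * (C * (K * (K ^ 3) ^ nat \<bar>r\<bar>))"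
      unfolding norm_mult using t by (intro mult_mono a1_bound wp_bound) auto
    thus ?thesis by (simp add: B_def \<theta>_def mult_ac)
  qed
  have bound2: "norm (a2 r * well_poised q x y (3*r + 1)) \<le> B * \<theta> r" for r
  proof -
    have "norm (a2 r * well_poised q x y (3*r + 1))
        \<le> (2 * t ^ ((nat \<bar>r\<bar>)\<^sup>2 - nat \<bar>r\<bar>)) * (C * (K * (K ^ 3) ^ nat \<bar>r\<bar>))"
      unfolding norm_mult using t by (intro mult_mono a2_bound wp_bound) auto
    thus ?thesis by (simp add: B_def \<theta>_def mult_ac)
  qed
  have \<theta>c: "(\<lambda>r. c * \<theta> r) summable_on UNIV" for c
    using \<theta> by (rule summable_on_cmult_right)
  have sum1: "S1_term x y q summable_on UNIV"
    by (rule abs_summable_summable[OF Infinite_Sum.abs_summable_on_comparison_test'[OF \<theta>c]])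
       (use bound1 S1 in auto)
  have sum2: "S2_term x y q summable_on UNIV"
    by (rule abs_summable_summable[OF Infinite_Sum.abs_summable_on_comparison_test'[OF \<theta>c]])
       (use bound2 S2 in auto)

  \<comment> \<open>The finite Bailey lemma applied to the pair\<close>
  define f where "f N r = qfac q (q / x) N * qfac q (q / y) N *
      (bailey_coeff q N (3*r) * (a1 r * well_poised q x y (3*r))
       + bailey_coeff q N (3*r + 1) * (a2 r * well_poised q x y (3*r + 1)))" for N r
  \<comment> \<open>Extension by 0 beyond \<open>N\<close> gives a fixed index set, as dominated
    convergence requires.\<close>
  define h where "h N n = (if n \<le> N then bailey_weight q x y N n * \<beta> n else 0)" for N n
  \<comment> \<open>The Bailey pair is summed with weights over \<open>n \<le> N\<close>;
    interchanging the sums leaves inner sums that \<open>bailey_weight_sum\<close>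
    evaluates.\<close>
  have finite_bailey: "infsum (f N) UNIV = infsum (h N) UNIV" for N
  proof -
    have "((\<lambda>r. \<Sum>n\<le>N. bailey_weight q x y N n *
          (a1 r * bailey_coeff q n (3*r) + a2 r * bailey_coeff q n (3*r + 1)))
        has_sum (\<Sum>n\<le>N. bailey_weight q x y N n * \<beta> n)) UNIV"
      unfolding a1_def a2_def \<beta>_def
      by (intro has_sum_finite_sum has_sum_cmult_right bailey_pair assms) auto
    moreover have "(\<Sum>n\<le>N. bailey_weight q x y N n *
          (a1 r * bailey_coeff q n (3*r) + a2 r * bailey_coeff q n (3*r + 1))) = f N r" for r
    proof -
      have "(\<Sum>n\<le>N. bailey_weight q x y N n *
          (a1 r * bailey_coeff q n (3*r) + a2 r * bailey_coeff q n (3*r + 1)))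
        = a1 r * (\<Sum>n\<le>N. bailey_weight q x y N n * bailey_coeff q n (3*r))
          + a2 r * (\<Sum>n\<le>N. bailey_weight q x y N n * bailey_coeff q n (3*r + 1))"
        by (simp add: sum_distrib_left distrib_left mult_ac flip: sum.distrib)
      thus ?thesis
        unfolding bailey_weight_sum[OF assms(1-4) nzx nzy] by (simp add: f_def algebra_simps)
    qed
    ultimately have "infsum (f N) UNIV = (\<Sum>n\<le>N. bailey_weight q x y N n * \<beta> n)"
      by (simp add: infsumI)
    also have "\<dots> = infsum (h N) {..N}"
      by (simp add: h_def)
    also have "\<dots> = infsum (h N) UNIV"
      by (intro infsum_cong_neutral) (auto simp: h_def)
    finally show ?thesis .
  qed

  \<comment> \<open>Limit of the bilateral side\<close>
  obtain Cx where Cx: "Cx > 0" "\<And>n. norm (qfac q (q / x) n) \<le> Cx"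
    using qfac_bounded[OF assms(2)] by blast
  obtain Cy where Cy: "Cy > 0" "\<And>n. norm (qfac q (q / y) n) \<le> Cy"
    using qfac_bounded[OF assms(2)] by blast
  obtain Cb where Cb: "Cb > 0" "\<And>n r. norm (bailey_coeff q n r) \<le> Cb"
    using bailey_coeff_bounded[OF assms(2)] by blast
  have f_bound: "norm (f N r) \<le> (Cx * Cy * (2 * Cb * B)) * \<theta> r" for N r
  proof -
    have "norm (bailey_coeff q N (3*r) * (a1 r * well_poised q x y (3*r))
        + bailey_coeff q N (3*r + 1) * (a2 r * well_poised q x y (3*r + 1))) \<le> Cb * (B * \<theta> r) + Cb * (B * \<theta> r)"
      unfolding norm_mult[of "bailey_coeff _ _ _"] using Cb
      by (intro norm_triangle_mono) (auto simp only: norm_mult[of "bailey_coeff _ _ _"] intro!: mult_mono bound1 bound2 norm_ge_zero)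
    hence "norm (f N r) \<le> (Cx * Cy) * (Cb * (B * \<theta> r) + Cb * (B * \<theta> r))"
      unfolding f_def norm_mult[of "_ * _" "_ + _"] norm_mult[of "qfac _ _ _"] using Cx Cy
      by (intro mult_mono) auto
    thus ?thesis by (simp add: algebra_simps)
  qed
  have f_lim: "(\<lambda>N. f N r) \<longlonglongrightarrow> ?X * ?Y *
      (1 / (?Q * ?Q) * (a1 r * well_poised q x y (3*r)) + 1 / (?Q * ?Q) * (a2 r * well_poised q x y (3*r + 1)))" for r
    unfolding f_def by (intro tendsto_intros qfac_tendsto bailey_coeff_tendsto assms)
  have "?X * ?Y * (1 / (?Q * ?Q) * (a1 r * well_poised q x y (3*r)) + 1 / (?Q * ?Q) * (a2 r * well_poised q x y (3*r + 1)))
      = (?X * ?Y / (?Q * ?Q)) * (S1_term x y q r - S2_term x y q r)" for r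
    unfolding S1 S2 using Q by (simp add: field_simps)
  note f_lim = f_lim[unfolded this]
  have "((\<lambda>r. (?X * ?Y / (?Q * ?Q)) * (S1_term x y q r - S2_term x y q r)) has_sum
      (?X * ?Y / (?Q * ?Q)) * (S1 x y q - S2 x y q)) UNIV"
    unfolding S1_def S2_def
    by (intro has_sum_cmult_right has_sum_diff_complex has_sum_infsum sum1 sum2)
  with tannery(1)[OF f_bound \<theta>c f_lim]
  have lim_f: "(\<lambda>N. infsum (f N) UNIV) \<longlonglongrightarrow> (?X * ?Y / (?Q * ?Q)) * (S1 x y q - S2 x y q)"
    by (simp add: infsumI)

  \<comment> \<open>Limit of the unilateral side\<close>
  obtain Cx' where Cx': "Cx' > 0" "\<And>n. norm (qfac q x n) \<le> Cx'"
    using qfac_bounded[OF assms(2)] by blast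
  obtain Cy' where Cy': "Cy' > 0" "\<And>n. norm (qfac q y n) \<le> Cy'"
    using qfac_bounded[OF assms(2)] by blast
  obtain Cd where Cd: "Cd > 0" "\<And>n. norm (qfac q d n) \<le> Cd"
    using qfac_bounded[OF assms(2)] by blast
  obtain Cq where Cq: "Cq > 0" "\<And>n. norm (1 / qfac q q n) \<le> Cq"
    using inverse_qfac_bounded[OF assms(2) qfac_base_nonzero[OF assms(2)]] by blast
  \<comment> \<open>Decay comes from \<open>q ^ (n\<^sup>2 - n)\<close> in \<open>\<beta> n\<close>,
    which beats \<open>norm d ^ n\<close> for every \<open>d\<close>; the other factors are bounded
    uniformly in \<open>N\<close> and \<open>n\<close>.\<close>
  have h_bound: "norm (h N n) \<le> (Cx' * Cy' * Cd * Cq * 2 * Cq) * (t ^ (n\<^sup>2 - n) * norm d ^ n)" for N n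
  proof (cases "n \<le> N")
    case True
    have "norm (q ^ n - 1) \<le> 2"
      using norm_triangle_ineq4[of "q ^ n" 1] power_le_one[of "norm q" n] assms(2)
      by (simp add: norm_power)
    hence "norm (qfac q x n) * norm (qfac q y n) * norm (qfac q d (N - n)) * norm (1 / qfac q q (N - n))
        * norm (q ^ n - 1) * norm (1 / qfac q q (2*n)) \<le> Cx' * Cy' * Cd * Cq * 2 * Cq"
      using Cx' Cy' Cd Cq by (intro mult_mono mult_nonneg_nonneg norm_ge_zero) auto
    hence "norm (qfac q x n) * norm (qfac q y n) * norm (qfac q d (N - n)) * norm (1 / qfac q q (N - n))
        * norm (q ^ n - 1) * norm (1 / qfac q q (2*n)) * (t ^ (n\<^sup>2 - n) * norm d ^ n)
        \<le> (Cx' * Cy' * Cd * Cq * 2 * Cq) * (t ^ (n\<^sup>2 - n) * norm d ^ n)"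
      using t by (intro mult_right_mono) auto
    thus ?thesis
      using True
      by (simp add: h_def bailey_weight_def \<beta>_def norm_mult norm_divide norm_power t_def mult_ac flip: d_def)
  next
    case False
    thus ?thesis using t Cx' Cy' Cd Cq by (simp add: h_def)
  qed
  have h_summable: "(\<lambda>n. (Cx' * Cy' * Cd * Cq * 2 * Cq) * (t ^ (n\<^sup>2 - n) * norm d ^ n)) summable_on UNIV"
    using t summable_theta[of t "norm d"]
    by (intro summable_on_cmult_right) (simp add: summable_on_UNIV_nonneg_real_iff)
  define T where "T n = (qpoch x q (int n) * qpoch y q (int n)) / qpoch q q (2 * int n)
              * (1 / (x * y)) ^ n * (q ^ n - 1) * q ^ (n\<^sup>2)" for n
  have h_lim: "(\<lambda>N. h N n) \<longlonglongrightarrow> (?D / ?Q) * T n" for n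
  proof -
    have lim: "(\<lambda>N. qfac q a (N - n)) \<longlonglongrightarrow> qpoch_inf a q" for a
      by (rule filterlim_compose[OF qfac_tendsto[OF assms(2)] filterlim_minus_const_nat_at_top])
    have "(\<lambda>N. bailey_weight q x y N n * \<beta> n) \<longlonglongrightarrow> qfac q x n * qfac q y n * ?D * d ^ n / ?Q * \<beta> n"
      unfolding bailey_weight_def d_def[symmetric] using Q by (intro tendsto_intros lim)
    moreover have "\<forall>\<^sub>F N in sequentially. bailey_weight q x y N n * \<beta> n = h N n"
      using eventually_ge_at_top[of n] by eventually_elim (simp add: h_def)
    ultimately have "(\<lambda>N. h N n) \<longlonglongrightarrow> qfac q x n * qfac q y n * ?D * d ^ n / ?Q * \<beta> n"
      by (rule Lim_transform_eventually)
    also have "qfac q x n * qfac q y n * ?D * d ^ n / ?Q * \<beta> n = (?D / ?Q) * T n"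
    proof -
      \<comment> \<open>The power \<open>d ^ n\<close> supplies the \<open>q ^ n\<close> that
        completes \<open>q ^ (n\<^sup>2 - n)\<close> to \<open>q ^ n\<^sup>2\<close>.\<close>
      have "q ^ n\<^sup>2 = q ^ n * q ^ (n\<^sup>2 - n)"
        by (simp add: power2_eq_square flip: power_add)
      moreover have "qpoch q q (2 * int n) = qfac q q (2 * n)"
        using qpoch_qfac[OF assms(2), of q "2 * n"] by simp
      ultimately show ?thesis
        by (simp add: T_def \<beta>_def d_def qpoch_qfac[OF assms(2)] power_divide mult_ac)
    qed
    finally show ?thesis .
  qed

  \<comment> \<open>Comparison of the two limits\<close>
  note h_tannery = tannery[OF h_bound h_summable h_lim]
  have "(\<lambda>n. (?Q / ?D) * ((?D / ?Q) * T n)) summable_on UNIV"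
    by (intro summable_on_cmult_right h_tannery(2))
  hence T: "T summable_on UNIV"
    using Q D by simp
  have "(\<lambda>N. infsum (h N) UNIV) \<longlonglongrightarrow> (?D / ?Q) * infsum T UNIV"
    using h_tannery(1) T by (simp only: infsum_cmult_right)
  from LIMSEQ_unique[OF this lim_f[unfolded finite_bailey]]
  have "infsum T UNIV = (S1 x y q - S2 x y q) * (?X * ?Y / (?Q * ?D))"
    using Q D by (simp add: field_simps)
  with has_sum_imp_sums[OF has_sum_infsum[OF T]] sum1 sum2 show ?thesis
    unfolding T_def d_def by simp
qed

end
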